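(* Let $\theta=\begin{bmatrix} a & b \\ b & c \end{bmatrix}\in\mathrm{Sym}^+(2,\mathbb{R})$ and $D=\sqrt{|\theta|}=\sqrt{ac-b^2}$. The differential entropy of the Poincaré distribution $p_\theta$ is $$h[p_\theta]=1+\log(\pi D)-2\log a-2e^{4D}\,\Gamma(0,4D).$$
   Context: $\mathbb{H}=\{(x,y)\in\mathbb{R}^2: y>0\}$. $\mathrm{Sym}^+(2,\mathbb{R})$ is the set of real symmetric positive-definite $2\times2$ matrices; $|\theta|$ denotes the determinant. The Poincaré distribution $p_\theta$ is the probability distribution on $\mathbb{H}$ with density (with respect to $dx\,dy$) $$p_\theta(x,y)=\frac{\sqrt{|\theta|}\,e^{2\sqrt{|\theta|}}}{\pi}\exp\left(-\frac{a(x^2+y^2)+2bx+c}{y}\right)\frac1{y^2}.$$ Its differential entropy is $h[p_\theta]=-\int_{\mathbb{H}}p_\theta(x,y)\log p_\theta(x,y)\,dx\,dy$. $\Gamma(s,x)=\int_x^\infty t^{s-1}e^{-t}\,dt$ is the upper incomplete Gamma function. *)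

theory Defs
  imports "HOL-Analysis.Analysis"
begin

definition upper_half_plane :: "(real \<times> real) set" where
  "upper_half_plane = {(x, y). y > 0}"

definition sym_pos_def :: "(real ^ 2 ^ 2) set" where
  "sym_pos_def = {A. transpose A = A \<and> (\<forall>v. v \<noteq> 0 \<longrightarrow> v \<bullet> (A *v v) > 0)}"

text \<open>The density is only meaningful on the upper half-plane: all integrals below are taken
  over that set, with respect to two-dimensional Lebesgue measure.\<close>

definition poincare_density :: "real ^ 2 ^ 2 \<Rightarrow> real \<times> real \<Rightarrow> real" where
  "poincare_density \<theta> = (\<lambda>(x, y).
     sqrt (det \<theta>) * exp (2 * sqrt (det \<theta>)) / pi *
     exp (- ((\<theta> $ 1 $ 1 * (x\<^sup>2 + y\<^sup>2) + 2 * \<theta> $ 1 $ 2 * x + \<theta> $ 2 $ 2) / y)) * (1 / y\<^sup>2))"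

text \<open>Differential entropy of a density \<open>p\<close> on \<open>S\<close>. A non-integrable
  integrand yields the value \<open>0\<close>, so existence is a separate predicate.\<close>

definition has_differential_entropy ::
    "'a::euclidean_space set \<Rightarrow> ('a \<Rightarrow> real) \<Rightarrow> bool" where
  "has_differential_entropy S p \<longleftrightarrow> set_integrable lborel S (\<lambda>z. p z * ln (p z))"

definition differential_entropy ::
    "'a::euclidean_space set \<Rightarrow> ('a \<Rightarrow> real) \<Rightarrow> real" where
  "differential_entropy S p = - (LINT z:S|lborel. p z * ln (p z))"

text \<open>The integral converges for \<open>x > 0\<close> and every real \<open>s\<close>, in particular \<open>s = 0\<close>.\<close>

definition upper_Gamma :: "real \<Rightarrow> real \<Rightarrow> real" where
  "upper_Gamma s x = (LINT t:{x..}|lborel. t powr (s - 1) * exp (- t))"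

end

theory Submission
  imports Defs "HOL-Probability.Distributions"
begin

text \<open>Completing the square in \<open>x\<close> and substituting
  \<open>x = - b / a + sqrt (y / a) * w\<close>, \<open>y = (D / a) * exp (2 * arsinh z)\<close> turns the
  exponent into \<open>- w\<^sup>2 - 2 * D - 4 * D * z\<^sup>2\<close> and the density into a Gaussian in
  \<open>(w, z)\<close> with the additional factor \<open>1 - z / sqrt (z\<^sup>2 + 1)\<close>. All contributions to the
  entropy are then Gaussian moments or vanish by oddness, except for the term
  \<open>z * arsinh z / sqrt (z\<^sup>2 + 1)\<close> coming from \<open>ln y\<close>. There, writing \<open>arsinh z\<close> as the
  integral of \<open>1 / sqrt (t\<^sup>2 + 1)\<close> over \<open>0 \<le> t \<le> z\<close> and replacing \<open>z\<close> by
  \<open>r = sqrt (z\<^sup>2 + 1) / sqrt (t\<^sup>2 + 1)\<close> separates the variables: the integral over \<open>t\<close> is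
  Gaussian, and the one over \<open>r \<ge> 1\<close> is an incomplete Gamma function.\<close>

section \<open>Change of variables on the real line\<close>

text \<open>Bridge between the gauge integral, for which the change of variables theorem is
  formulated, and the Bochner integral over \<open>lborel\<close>. For a Borel integrand, completing
  the measure alters neither integrability nor the value.\<close>

lemma has_bochner_integral_indicator_iff_absolutely_integrable:
  fixes f :: "real \<Rightarrow> real"
  assumes [measurable]: "(\<lambda>x. indicator S x * f x) \<in> borel_measurable borel"
  shows "has_bochner_integral lborel (\<lambda>x. indicator S x * f x) I \<longleftrightarrow>
    f absolutely_integrable_on S \<and> integral S f = I"
proof -
  have 1: "f absolutely_integrable_on S \<longleftrightarrow> integrable lborel (\<lambda>x. indicator S x * f x)"
    unfolding set_integrable_def by (simp add: integrable_completion)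
  have 2: "integral S f = (\<integral>x. indicator S x * f x \<partial>lborel)" if "f absolutely_integrable_on S"
    using set_lebesgue_integral_eq_integral(2)[OF that]
    by (simp add: set_lebesgue_integral_def integral_completion)
  show ?thesis
    using 1 2 by (auto simp: has_bochner_integral_iff)
qed

text \<open>The equivalence carries integrability as well as the value, and it is used in both
  directions below.\<close>

lemma has_bochner_integral_substitution:
  fixes f g g' :: "real \<Rightarrow> real"
  assumes "S \<in> sets borel" and "g ` S = T"
    and "\<And>x. x \<in> S \<Longrightarrow> (g has_field_derivative g' x) (at x within S)"
    and "inj_on g S"
    and "(\<lambda>x. indicator T x * f x) \<in> borel_measurable borel"
    and "(\<lambda>x. indicator S x * (\<bar>g' x\<bar> * f (g x))) \<in> borel_measurable borel"
  shows "has_bochner_integral lborel (\<lambda>x. indicator T x * f x) I \<longleftrightarrow>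
    has_bochner_integral lborel (\<lambda>x. indicator S x * (\<bar>g' x\<bar> * f (g x))) I"
proof -
  have "S \<in> sets lebesgue"
    using assms(1) by simp
  from has_absolute_integral_change_of_variables_1'[OF this assms(3,4)] show ?thesis
    using assms(2,5,6) by (simp add: has_bochner_integral_indicator_iff_absolutely_integrable)
qed

text \<open>Integrability transfers along the substitution, so the two integrals are either both
  finite and equal or both infinite. This form fits iterated integrals and Tonelli's
  theorem.\<close>

lemma nn_integral_substitution_nonneg:
  fixes f g g' :: "real \<Rightarrow> real"
  assumes "S \<in> sets borel" and "g ` S = T"
    and "\<And>x. x \<in> S \<Longrightarrow> (g has_field_derivative g' x) (at x within S)"
    and "inj_on g S"
    and "(\<lambda>x. indicator T x * f x) \<in> borel_measurable borel"
    and "(\<lambda>x. indicator S x * (\<bar>g' x\<bar> * f (g x))) \<in> borel_measurable borel"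
    and nonneg: "\<And>x. x \<in> T \<Longrightarrow> 0 \<le> f x"
  shows "(\<integral>\<^sup>+x. ennreal (indicator T x * f x) \<partial>lborel) =
    (\<integral>\<^sup>+x. ennreal (indicator S x * (\<bar>g' x\<bar> * f (g x))) \<partial>lborel)"
    (is "integral\<^sup>N _ (\<lambda>x. ennreal (?F x)) = integral\<^sup>N _ (\<lambda>x. ennreal (?G x))")
proof -
  note sub = has_bochner_integral_substitution[OF assms(1-6)]
  have [simp]: "0 \<le> ?F x" "0 \<le> ?G x" for x
    using nonneg[of x] nonneg[of "g x"] assms(2) by (auto simp: indicator_def)
  show ?thesis
  proof (cases "integrable lborel ?F")
    case True
    then have "has_bochner_integral lborel ?F (integral\<^sup>L lborel ?F)"
      by (rule has_bochner_integral_integrable)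
    with sub have "has_bochner_integral lborel ?G (integral\<^sup>L lborel ?F)"
      by blast
    then show ?thesis
      using True by (auto simp: nn_integral_eq_integral has_bochner_integral_iff)
  next
    case False
    then have "\<not> integrable lborel ?G"
      using sub by (auto simp: has_bochner_integral_iff)
    then show ?thesis
      using False assms(5,6)
      by (auto simp: integrable_iff_bounded top_unique not_less less_top)
  qed
qed

section \<open>Gaussian moments and odd integrands\<close>

text \<open>The half-line moment with unit parameter is doubled by evenness and rescaled by
  \<open>sqrt k\<close>. The cases \<open>n = 0\<close> and \<open>n = 1\<close> supply all masses
  and second moments below.\<close>

lemma has_bochner_integral_gaussian_even_moment:
  fixes k :: real
  assumes "0 < k"
  shows "has_bochner_integral lborel (\<lambda>x. x ^ (2 * n) * exp (- (k * x\<^sup>2)))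
    (sqrt (pi / k) * fact (2 * n) / ((4 * k) ^ n * fact n))"
proof -
  have "has_bochner_integral lborel (\<lambda>x. exp (- x\<^sup>2) * x ^ (2 * n))
      (2 *\<^sub>R (sqrt pi / 2 * (fact (2 * n) / (2 ^ (2 * n) * fact n))))"
    by (rule has_bochner_integral_even_function[OF gaussian_moment_even_pos]) simp
  then have "has_bochner_integral lborel (\<lambda>x. exp (- (sqrt k * x)\<^sup>2) * (sqrt k * x) ^ (2 * n))
      (sqrt pi * (fact (2 * n) / (2 ^ (2 * n) * fact n)) / sqrt k)"
    using assms
    by (subst (asm) lborel_has_bochner_integral_real_affine_iff[where c="sqrt k" and t=0])
       (auto simp: field_simps)
  from has_bochner_integral_mult_right[OF this, of "1 / k ^ n"]
  have *: "has_bochner_integral lborel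
      (\<lambda>x. 1 / k ^ n * (exp (- (sqrt k * x)\<^sup>2) * (sqrt k * x) ^ (2 * n)))
      (1 / k ^ n * (sqrt pi * (fact (2 * n) / (2 ^ (2 * n) * fact n)) / sqrt k))"
    by simp
  have "1 / k ^ n * (exp (- (sqrt k * x)\<^sup>2) * (sqrt k * x) ^ (2 * n)) =
      x ^ (2 * n) * exp (- (k * x\<^sup>2))" for x
  proof -
    have "sqrt k ^ (2 * n) = k ^ n"
      using assms by (simp only: power_mult) simp
    then have *: "(sqrt k * x) ^ (2 * n) = k ^ n * x ^ (2 * n)"
      by (simp add: power_mult_distrib)
    have "(sqrt k * x)\<^sup>2 = k * x\<^sup>2"
      using assms by (simp add: power_mult_distrib)
    then show ?thesis
      using assms unfolding * by simp
  qed
  moreover have "1 / k ^ n * (sqrt pi * (fact (2 * n) / (2 ^ (2 * n) * fact n)) / sqrt k) =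
      sqrt (pi / k) * fact (2 * n) / ((4 * k) ^ n * fact n)"
    using assms by (simp only: power_mult power_mult_distrib) (simp add: real_sqrt_divide)
  ultimately show ?thesis
    using * by simp
qed

lemma has_bochner_integral_gaussian_half_line:
  fixes k :: real
  assumes "0 < k"
  shows "has_bochner_integral lborel (\<lambda>x. indicator {0..} x * exp (- (k * x\<^sup>2))) (sqrt (pi / k) / 2)"
proof -
  have "has_bochner_integral lborel (\<lambda>x. indicator {0..} (sqrt k * x) * exp (- (sqrt k * x)\<^sup>2))
      (sqrt pi / 2 / sqrt k)"
    using assms gaussian_moment_0
    by (subst (asm) lborel_has_bochner_integral_real_affine_iff[where c="sqrt k" and t=0])
       (auto simp: field_simps)
  moreover have "indicator {0..} (sqrt k * x) * exp (- (sqrt k * x)\<^sup>2) =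
      indicator {0..} x * exp (- (k * x\<^sup>2))" for x
    using assms by (auto simp: indicator_def zero_le_mult_iff power_mult_distrib)
  ultimately show ?thesis
    by (simp add: real_sqrt_divide mult_ac)
qed

lemma has_bochner_integral_odd_zero:
  fixes f :: "real \<Rightarrow> real"
  assumes "integrable lborel f" and "\<And>x. f (- x) = - f x"
  shows "has_bochner_integral lborel f 0"
proof -
  have "integral\<^sup>L lborel f = - integral\<^sup>L lborel f"
    using lborel_integral_real_affine[of "-1" f 0] by (simp add: assms(2))
  with assms(1) show ?thesis
    by (simp add: has_bochner_integral_iff)
qed

section \<open>Bounds and an integral representation for \<open>arsinh\<close>\<close>

lemma arsinh_borel_measurable [measurable]: "(arsinh :: real \<Rightarrow> real) \<in> borel_measurable borel"
  by (intro borel_measurable_continuous_onI continuous_on_arsinh)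

lemma arsinh_real_nonneg: "0 \<le> (z::real) \<Longrightarrow> 0 \<le> arsinh z"
  using arsinh_real_neg_iff[of z] by linarith

text \<open>On the half-line, \<open>z - arsinh z\<close> has nonnegative derivative; oddness gives
  the rest. The bound makes \<open>arsinh\<close> integrable against a Gaussian.\<close>

lemma abs_arsinh_real_le: "\<bar>arsinh z\<bar> \<le> \<bar>z :: real\<bar>"
proof -
  have *: "arsinh z \<le> z" if "0 \<le> z" for z :: real
  proof -
    have "((\<lambda>z. z - arsinh z) has_field_derivative 1 - 1 / sqrt (x\<^sup>2 + 1)) (at x)" for x :: real
      by (auto intro!: derivative_eq_intros)
    moreover have "0 \<le> 1 - 1 / sqrt (x\<^sup>2 + 1)" for x :: real
      using add_nonneg_pos[of "x\<^sup>2" 1] by (simp add: divide_le_eq_1)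
    ultimately have "0 - arsinh 0 \<le> z - arsinh z"
      by (intro DERIV_nonneg_imp_nondecreasing[of 0 z "\<lambda>z. z - arsinh z"] exI conjI that)
    then show ?thesis by simp
  qed
  show ?thesis
    using *[of z] *[of "-z"] arsinh_real_nonneg[of z] arsinh_real_nonneg[of "-z"]
    by (cases "0 \<le> z") auto
qed

lemma nn_integral_arsinh:
  fixes z :: real
  assumes "0 \<le> z"
  shows "(\<integral>\<^sup>+t. ennreal (indicator {0..z} t * (1 / sqrt (t\<^sup>2 + 1))) \<partial>lborel) = ennreal (arsinh z)"
proof -
  have "(\<integral>\<^sup>+t. ennreal (1 / sqrt (t\<^sup>2 + 1)) * indicator {0..z} t \<partial>lborel) = ennreal (arsinh z - arsinh 0)"
    using assms
    by (intro nn_integral_FTC_Icc)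
       (auto intro!: arsinh_real_has_field_derivative)
  then show ?thesis
    by (simp add: indicator_mult_ennreal mult.commute)
qed

section \<open>The even \<open>arsinh\<close> term and the incomplete Gamma function\<close>

text \<open>For fixed \<open>t\<close>, put
  \<open>r = sqrt (z\<^sup>2 + 1) / sqrt (t\<^sup>2 + 1)\<close>. Then
  \<open>k * r\<^sup>2 * (t\<^sup>2 + 1)\<close> equals \<open>k * z\<^sup>2 + k\<close>, the
  summand \<open>k\<close> in the exponent absorbs the shift, and the Jacobian supplies the factor
  in front of the Gaussian.\<close>

lemma nn_integral_gaussian_tail_substitution:
  fixes k t :: real
  assumes "0 \<le> t"
  shows "(\<integral>\<^sup>+r. ennreal (indicator {1..} r * exp (k - k * r\<^sup>2 * (t\<^sup>2 + 1))) \<partial>lborel) =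
    (\<integral>\<^sup>+z. ennreal (indicator {t..} z * (z / sqrt (z\<^sup>2 + 1) / sqrt (t\<^sup>2 + 1) * exp (- (k * z\<^sup>2)))) \<partial>lborel)"
proof -
  let ?g = "\<lambda>z::real. sqrt (z\<^sup>2 + 1) / sqrt (t\<^sup>2 + 1)"
  let ?g' = "\<lambda>z::real. z / sqrt (z\<^sup>2 + 1) / sqrt (t\<^sup>2 + 1)"
  have pos: "0 < z\<^sup>2 + 1" for z :: real
    by (simp add: add_nonneg_pos)
  have img: "?g ` {t..} = {1..}"
  proof (intro equalityI subsetI)
    fix r assume "r \<in> ?g ` {t..}"
    then obtain z where "t \<le> z" "r = ?g z" by auto
    then show "r \<in> {1..}"
      using assms pos[of t] by (auto simp: le_divide_eq)
  next
    fix r :: real assume "r \<in> {1..}"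
    then have r: "1 \<le> r" by simp
    \<comment> \<open>The nonnegative solution \<open>z\<close> of \<open>?g z = r\<close>.\<close>
    let ?z = "sqrt (r\<^sup>2 * (t\<^sup>2 + 1) - 1)"
    have "1 * (t\<^sup>2 + 1) \<le> r\<^sup>2 * (t\<^sup>2 + 1)"
      using r by (intro mult_right_mono) auto
    then have z: "t\<^sup>2 \<le> r\<^sup>2 * (t\<^sup>2 + 1) - 1" by simp
    then have "t \<le> ?z"
      by (rule real_le_rsqrt)
    moreover have "0 \<le> r\<^sup>2 * (t\<^sup>2 + 1) - 1"
      using z by (meson order_trans zero_le_power2)
    then have "?g ?z = r"
      using r pos[of t] by (simp add: real_sqrt_mult)
    ultimately show "r \<in> ?g ` {t..}"
      by (intro image_eqI[of _ _ ?z]) auto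
  qed
  have inj: "inj_on ?g {t..}"
    using assms pos[of t] by (auto intro!: inj_onI simp: power2_eq_iff)
  have der: "(?g has_field_derivative ?g' z) (at z within {t..})" for z
  proof (rule DERIV_cdivide)
    have "((\<lambda>z. z\<^sup>2 + 1) has_field_derivative 2 * z) (at z within {t..})"
      by (rule derivative_eq_intros refl | simp)+
    from DERIV_chain2[OF DERIV_real_sqrt[OF pos] this]
    show "((\<lambda>z. sqrt (z\<^sup>2 + 1)) has_field_derivative z / sqrt (z\<^sup>2 + 1)) (at z within {t..})"
      by (rule DERIV_cong) (simp add: inverse_eq_divide)
  qed
  have eq: "\<bar>?g' z\<bar> * exp (k - k * (?g z)\<^sup>2 * (t\<^sup>2 + 1)) = ?g' z * exp (- (k * z\<^sup>2))" if "t \<le> z" for z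
  proof -
    have "(?g z)\<^sup>2 * (t\<^sup>2 + 1) = z\<^sup>2 + 1"
      using pos[of t] pos[of z] by (simp add: power_divide)
    then have "k - k * (?g z)\<^sup>2 * (t\<^sup>2 + 1) = k - k * (z\<^sup>2 + 1)"
      by (simp only: mult.assoc)
    also have "\<dots> = - (k * z\<^sup>2)"
      by (simp add: algebra_simps)
    finally have "k - k * (?g z)\<^sup>2 * (t\<^sup>2 + 1) = - (k * z\<^sup>2)" .
    moreover have "0 \<le> ?g' z"
      using that assms by simp
    ultimately show ?thesis
      by (simp only: abs_of_nonneg)
  qed
  have "(\<integral>\<^sup>+r. ennreal (indicator {1..} r * exp (k - k * r\<^sup>2 * (t\<^sup>2 + 1))) \<partial>lborel) =
    (\<integral>\<^sup>+z. ennreal (indicator {t..} z * (\<bar>?g' z\<bar> * exp (k - k * (?g z)\<^sup>2 * (t\<^sup>2 + 1)))) \<partial>lborel)"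
    by (rule nn_integral_substitution_nonneg[OF _ img der inj]) simp_all
  also have "\<dots> = (\<integral>\<^sup>+z. ennreal (indicator {t..} z * (?g' z * exp (- (k * z\<^sup>2)))) \<partial>lborel)"
  proof (rule nn_integral_cong)
    fix z :: real
    show "ennreal (indicator {t..} z * (\<bar>?g' z\<bar> * exp (k - k * (?g z)\<^sup>2 * (t\<^sup>2 + 1)))) =
        ennreal (indicator {t..} z * (?g' z * exp (- (k * z\<^sup>2))))"
    proof (cases "t \<le> z")
      case True
      then show ?thesis by (simp only: eq)
    qed simp
  qed
  finally show ?thesis .
qed

text \<open>Under \<open>t = k * r\<^sup>2\<close> the measure dt / t becomes 2 dr / r, whence the
  factor 1 / 2.\<close>

lemma nn_integral_upper_Gamma_0:
  fixes k :: real
  assumes "0 < k"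
  shows "(\<integral>\<^sup>+r. ennreal (indicator {1..} r * (exp (- (k * r\<^sup>2)) / r)) \<partial>lborel) =
    ennreal (upper_Gamma 0 k / 2)"
proof -
  let ?f = "\<lambda>t::real. exp (- t) / t"
  \<comment> \<open>A dominating function: \<open>1 / t \<le> 1 / k\<close> on the range of
    integration.\<close>
  have "integrable lborel (\<lambda>t. indicator {k..} t *\<^sub>R (exp (- t) / k))"
  proof -
    have "(\<lambda>t. exp (- 1 * t)) absolutely_integrable_on {k..}"
      using has_integral_exp_minus_to_infinity[of 1 k]
      by (intro nonnegative_absolutely_integrable_1) (auto simp: integrable_on_def)
    then have "has_bochner_integral lborel (\<lambda>t. indicator {k..} t * exp (- t)) (integral {k..} (\<lambda>t. exp (- t)))"
      by (subst has_bochner_integral_indicator_iff_absolutely_integrable) auto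
    then have "integrable lborel (\<lambda>t. indicator {k..} t * exp (- t) / k)"
      by (intro Bochner_Integration.integrable_divide_zero) (simp add: has_bochner_integral_iff)
    then show ?thesis by simp
  qed
  then have int: "integrable lborel (\<lambda>t. indicator {k..} t * ?f t)"
    by (rule Bochner_Integration.integrable_bound)
       (use assms in \<open>auto simp: indicator_def frac_le\<close>)
  have "upper_Gamma 0 k = (\<integral>t. indicator {k..} t * ?f t \<partial>lborel)"
    unfolding upper_Gamma_def set_lebesgue_integral_def
    using assms by (intro Bochner_Integration.integral_cong) (auto simp: indicator_def powr_minus field_simps)
  then have Gamma: "ennreal (upper_Gamma 0 k) = (\<integral>\<^sup>+t. ennreal (indicator {k..} t * ?f t) \<partial>lborel)"
    using int assms by (subst nn_integral_eq_integral) (auto simp: indicator_def)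
  have half: "ennreal (1 / 2) * ennreal x = ennreal (1 / 2 * x)" for x
    by (rule ennreal_mult'[symmetric]) simp
  have "(\<integral>\<^sup>+r. ennreal (indicator {1..} r * (exp (- (k * r\<^sup>2)) / r)) \<partial>lborel) =
      (\<integral>\<^sup>+r. ennreal (1 / 2) * ennreal (indicator {1..} r * (\<bar>2 * k * r\<bar> * ?f (k * r\<^sup>2))) \<partial>lborel)"
    unfolding half using assms
    by (intro nn_integral_cong) (auto simp: indicator_def power2_eq_square)
  also have "\<dots> = ennreal (1 / 2) *
      (\<integral>\<^sup>+r. ennreal (indicator {1..} r * (\<bar>2 * k * r\<bar> * ?f (k * r\<^sup>2))) \<partial>lborel)"
    by (rule nn_integral_cmult) simp
  also have "(\<integral>\<^sup>+r. ennreal (indicator {1..} r * (\<bar>2 * k * r\<bar> * ?f (k * r\<^sup>2))) \<partial>lborel) =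
      (\<integral>\<^sup>+t. ennreal (indicator {k..} t * ?f t) \<partial>lborel)"
  proof (rule nn_integral_substitution_nonneg[symmetric])
    show "(\<lambda>r. k * r\<^sup>2) ` {1..} = {k..}"
    proof (intro equalityI subsetI)
      fix t assume "t \<in> {k..}"
      then show "t \<in> (\<lambda>r. k * r\<^sup>2) ` {1..}"
        using assms by (intro image_eqI[of _ _ "sqrt (t / k)"]) auto
    qed (use assms in auto)
    show "inj_on (\<lambda>r. k * r\<^sup>2) {1..}"
      using assms by (auto intro!: inj_onI simp: power2_eq_iff)
  qed (use assms in \<open>auto intro!: derivative_eq_intros\<close>)
  also have "ennreal (1 / 2) * \<dots> = ennreal (upper_Gamma 0 k / 2)"
    unfolding Gamma[symmetric] half by simp
  finally show ?thesis .
qed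

text \<open>The integrand is even, so its half-line integral is computed and doubled. On the
  half-line everything is nonnegative, and Tonelli's theorem is applied twice: once to fix
  \<open>t\<close> before substituting for \<open>z\<close>, once to integrate over \<open>t\<close>
  before \<open>r\<close>.\<close>

lemma has_bochner_integral_arsinh_gaussian:
  fixes k :: real
  assumes k: "0 < k"
  shows "has_bochner_integral lborel (\<lambda>z. z * arsinh z / sqrt (z\<^sup>2 + 1) * exp (- (k * z\<^sup>2)))
    (sqrt (pi / k) / 2 * exp k * upper_Gamma 0 k)"
proof -
  let ?w = "\<lambda>z t::real. z / sqrt (z\<^sup>2 + 1) / sqrt (t\<^sup>2 + 1) * exp (- (k * z\<^sup>2))"
  let ?f = "\<lambda>z. z * arsinh z / sqrt (z\<^sup>2 + 1) * exp (- (k * z\<^sup>2))"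
  have Gamma_nonneg: "0 \<le> upper_Gamma 0 k"
    unfolding upper_Gamma_def set_lebesgue_integral_def
    by (intro Bochner_Integration.integral_nonneg) auto
  have "(\<integral>\<^sup>+z. ennreal (indicator {0..} z * ?f z) \<partial>lborel) =
      (\<integral>\<^sup>+z. (\<integral>\<^sup>+t. ennreal (indicator {0..} z * indicator {0..z} t * ?w z t) \<partial>lborel) \<partial>lborel)"
  proof (rule nn_integral_cong)
    fix z :: real
    let ?c = "indicator {0..} z * (z / sqrt (z\<^sup>2 + 1) * exp (- (k * z\<^sup>2)))"
    have c: "0 \<le> ?c" by (simp add: indicator_def)
    have "(\<integral>\<^sup>+t. ennreal (indicator {0..} z * indicator {0..z} t * ?w z t) \<partial>lborel) =
        (\<integral>\<^sup>+t. ennreal ?c * ennreal (indicator {0..z} t * (1 / sqrt (t\<^sup>2 + 1))) \<partial>lborel)"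
      using c by (intro nn_integral_cong) (simp add: ennreal_mult'[symmetric] mult_ac)
    also have "\<dots> = ennreal ?c * (\<integral>\<^sup>+t. ennreal (indicator {0..z} t * (1 / sqrt (t\<^sup>2 + 1))) \<partial>lborel)"
      by (rule nn_integral_cmult) simp
    also have "\<dots> = ennreal (indicator {0..} z * ?f z)"
    proof (cases "0 \<le> z")
      case True
      then show ?thesis
        using c by (simp only: nn_integral_arsinh) (simp add: ennreal_mult[symmetric] arsinh_real_nonneg mult_ac)
    qed simp
    finally show "ennreal (indicator {0..} z * ?f z) =
        (\<integral>\<^sup>+t. ennreal (indicator {0..} z * indicator {0..z} t * ?w z t) \<partial>lborel)" by simp
  qed
  \<comment> \<open>Both products of indicators describe 0 \<le> t \<le> z; the new one is suited to
    fixing \<open>t\<close> first.\<close>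
  also have "\<dots> = (\<integral>\<^sup>+z. (\<integral>\<^sup>+t. ennreal (indicator {0..} t * (indicator {t..} z * ?w z t)) \<partial>lborel) \<partial>lborel)"
    by (intro nn_integral_cong) (auto simp: indicator_def)
  also have "\<dots> = (\<integral>\<^sup>+t. (\<integral>\<^sup>+z. ennreal (indicator {0..} t * (indicator {t..} z * ?w z t)) \<partial>lborel) \<partial>lborel)"
  proof (rule lborel_pair.Fubini'[symmetric])
    \<comment> \<open>The set \<open>{t..}\<close> varies with \<open>t\<close>; as a fixed closed
      subset of the plane the region is recognised as measurable.\<close>
    have "(\<lambda>(z, t). indicator {0..} t * (indicator {p. snd p \<le> fst p} (z, t) * ?w z t))
        \<in> borel_measurable (lborel \<Otimes>\<^sub>M lborel)"
      by measurable
    then show "(\<lambda>(z, t). ennreal (indicator {0..} t * (indicator {t..} z * ?w z t)))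
        \<in> borel_measurable (lborel \<Otimes>\<^sub>M lborel)"
      by (simp add: indicator_def case_prod_beta)
  qed
  also have "\<dots> = (\<integral>\<^sup>+t. (\<integral>\<^sup>+r. ennreal (indicator {0..} t * (indicator {1..} r * exp (k - k * r\<^sup>2 * (t\<^sup>2 + 1)))) \<partial>lborel) \<partial>lborel)"
  proof (rule nn_integral_cong)
    fix t :: real
    show "(\<integral>\<^sup>+z. ennreal (indicator {0..} t * (indicator {t..} z * ?w z t)) \<partial>lborel) =
        (\<integral>\<^sup>+r. ennreal (indicator {0..} t * (indicator {1..} r * exp (k - k * r\<^sup>2 * (t\<^sup>2 + 1)))) \<partial>lborel)"
      by (cases "0 \<le> t") (simp_all add: nn_integral_gaussian_tail_substitution)
  qed
  also have "\<dots> = (\<integral>\<^sup>+r. (\<integral>\<^sup>+t. ennreal (indicator {0..} t * (indicator {1..} r * exp (k - k * r\<^sup>2 * (t\<^sup>2 + 1)))) \<partial>lborel) \<partial>lborel)"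
    by (rule lborel_pair.Fubini'[symmetric]) measurable
  also have "\<dots> = (\<integral>\<^sup>+r. ennreal (sqrt (pi / k) / 2 * exp k) *
      ennreal (indicator {1..} r * (exp (- (k * r\<^sup>2)) / r)) \<partial>lborel)"
  proof (rule nn_integral_cong)
    fix r :: real
    show "(\<integral>\<^sup>+t. ennreal (indicator {0..} t * (indicator {1..} r * exp (k - k * r\<^sup>2 * (t\<^sup>2 + 1)))) \<partial>lborel) =
        ennreal (sqrt (pi / k) / 2 * exp k) * ennreal (indicator {1..} r * (exp (- (k * r\<^sup>2)) / r))"
    proof (cases "1 \<le> r")
      case True
      then have pos: "0 < k * r\<^sup>2" using k by simp
      \<comment> \<open>For fixed \<open>r\<close> this is \<open>exp (k - k * r\<^sup>2)\<close>
        times a half-line Gaussian with parameter \<open>k * r\<^sup>2\<close>, whose mass is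
        \<open>sqrt (pi / k) / (2 * r)\<close>.\<close>
      have "(\<integral>\<^sup>+t. ennreal (indicator {0..} t * (indicator {1..} r * exp (k - k * r\<^sup>2 * (t\<^sup>2 + 1)))) \<partial>lborel) =
        (\<integral>\<^sup>+t. ennreal (exp k * exp (- (k * r\<^sup>2))) * ennreal (indicator {0..} t * exp (- (k * r\<^sup>2 * t\<^sup>2))) \<partial>lborel)"
      proof (rule nn_integral_cong)
        fix t :: real
        have "exp (k - k * r\<^sup>2 * (t\<^sup>2 + 1)) = exp (k + - (k * r\<^sup>2) + - (k * r\<^sup>2 * t\<^sup>2))"
          by (simp add: algebra_simps)
        also have "\<dots> = exp k * exp (- (k * r\<^sup>2)) * exp (- (k * r\<^sup>2 * t\<^sup>2))"
          by (simp only: exp_add)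
        finally show "ennreal (indicator {0..} t * (indicator {1..} r * exp (k - k * r\<^sup>2 * (t\<^sup>2 + 1)))) =
            ennreal (exp k * exp (- (k * r\<^sup>2))) * ennreal (indicator {0..} t * exp (- (k * r\<^sup>2 * t\<^sup>2)))"
          using True by (simp add: ennreal_mult'[symmetric] mult_ac)
      qed
      also have "\<dots> = ennreal (exp k * exp (- (k * r\<^sup>2))) *
          (\<integral>\<^sup>+t. ennreal (indicator {0..} t * exp (- (k * r\<^sup>2 * t\<^sup>2))) \<partial>lborel)"
        by (rule nn_integral_cmult) simp
      also have "(\<integral>\<^sup>+t. ennreal (indicator {0..} t * exp (- (k * r\<^sup>2 * t\<^sup>2))) \<partial>lborel) =
          ennreal (sqrt (pi / (k * r\<^sup>2)) / 2)"
      proof -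
        note half = has_bochner_integral_gaussian_half_line[OF pos]
        show ?thesis
          using nn_integral_eq_integral[OF integrable.intros[OF half]]
          unfolding has_bochner_integral_integral_eq[OF half] by simp
      qed
      also have "sqrt (pi / (k * r\<^sup>2)) = sqrt (pi / k) / r"
        using True by (simp add: real_sqrt_divide real_sqrt_mult)
      finally show ?thesis
        using True k by (simp add: ennreal_mult'[symmetric] mult_ac)
    qed simp
  qed
  also have "\<dots> = ennreal (sqrt (pi / k) / 2 * exp k) * ennreal (upper_Gamma 0 k / 2)"
    using nn_integral_upper_Gamma_0[OF k] by (subst nn_integral_cmult) auto
  also have "\<dots> = ennreal (sqrt (pi / k) / 2 * exp k * (upper_Gamma 0 k / 2))"
    using k Gamma_nonneg by (subst ennreal_mult) auto
  \<comment> \<open>Finiteness of the nonnegative integral yields integrability.\<close>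
  finally have "has_bochner_integral lborel (\<lambda>z. indicator {0..} z * ?f z)
      (sqrt (pi / k) / 2 * exp k * (upper_Gamma 0 k / 2))"
    using k Gamma_nonneg
    by (intro has_bochner_integral_nn_integral) (auto simp: indicator_def arsinh_real_nonneg)
  then have "has_bochner_integral lborel ?f (2 *\<^sub>R (sqrt (pi / k) / 2 * exp k * (upper_Gamma 0 k / 2)))"
    by (intro has_bochner_integral_even_function) simp_all
  then show ?thesis by (simp add: mult_ac)
qed

section \<open>Integration over the half-plane by horizontal fibres\<close>

text \<open>Stretching the profile \<open>\<kappa>\<close> by \<open>s y\<close> multiplies its
  integral by \<open>s y\<close>, so the planar integral factors into a height integral and a fixed
  profile integral. Positivity of \<open>s\<close> is asked for where \<open>h\<close> is nonzero,
  so that \<open>h\<close> may carry the indicator of the half-plane.\<close>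

lemma has_bochner_integral_scaled_fibres:
  fixes h s \<kappa> :: "real \<Rightarrow> real"
  assumes \<kappa>: "has_bochner_integral lborel \<kappa> A"
    and h: "has_bochner_integral lborel (\<lambda>y. h y * s y) B"
    and [measurable]: "h \<in> borel_measurable borel" "s \<in> borel_measurable borel" "\<kappa> \<in> borel_measurable borel"
    and s: "\<And>y. h y \<noteq> 0 \<Longrightarrow> 0 < s y"
  shows "has_bochner_integral lborel (\<lambda>(x, y). h y * \<kappa> ((x - m) / s y)) (B * A)"
proof -
  have fibre: "has_bochner_integral lborel (\<lambda>x. h y * \<phi> ((x - m) / s y)) (h y * s y * I)"
    if "has_bochner_integral lborel \<phi> I" for y I and \<phi> :: "real \<Rightarrow> real"
  proof (cases "h y = 0")
    case False
    then have sy: "0 < s y" by (rule s)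
    then have "has_bochner_integral lborel (\<lambda>x. \<phi> (- (m / s y) + 1 / s y * x)) (I /\<^sub>R \<bar>1 / s y\<bar>)"
      using that by (subst (asm) lborel_has_bochner_integral_real_affine_iff[where c="1 / s y" and t="- (m / s y)"]) auto
    moreover have "- (m / s y) + 1 / s y * x = (x - m) / s y" for x
      by (simp add: diff_divide_distrib)
    ultimately have "has_bochner_integral lborel (\<lambda>x. \<phi> ((x - m) / s y)) (s y * I)"
      using sy by (simp add: divide_inverse)
    from has_bochner_integral_mult_right[OF this, of "h y"] show ?thesis
      by (simp add: mult_ac)
  qed (simp add: has_bochner_integral_zero)
  let ?f = "\<lambda>x y. h y * \<kappa> ((x - m) / s y)"
  have meas[measurable]: "case_prod ?f \<in> borel_measurable (lborel \<Otimes>\<^sub>M lborel)"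
    by measurable
  \<comment> \<open>The fibre formula applied to the absolute value of \<open>\<kappa>\<close> gives
    the fibre norms that Fubini's theorem asks for; \<open>h y\<close> has constant sign along a
    fibre.\<close>
  have abs_\<kappa>: "has_bochner_integral lborel (\<lambda>w. \<bar>\<kappa> w\<bar>) (\<integral>w. \<bar>\<kappa> w\<bar> \<partial>lborel)"
    using \<kappa> by (simp add: has_bochner_integral_iff)
  have norm_eq: "(\<integral>x. norm (?f x y) \<partial>lborel) = \<bar>h y * s y\<bar> * (\<integral>w. \<bar>\<kappa> w\<bar> \<partial>lborel)" for y
  proof -
    have "(\<integral>x. norm (?f x y) \<partial>lborel) = \<bar>\<integral>x. h y * \<bar>\<kappa> ((x - m) / s y)\<bar> \<partial>lborel\<bar>"
      by (simp add: abs_mult)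
    also have "\<dots> = \<bar>h y * s y * (\<integral>w. \<bar>\<kappa> w\<bar> \<partial>lborel)\<bar>"
      using fibre[OF abs_\<kappa>, of y] by (simp only: has_bochner_integral_iff)
    finally show ?thesis by (simp add: abs_mult)
  qed
  \<comment> \<open>The pair is swapped because the criterion integrates over the second coordinate
    first.\<close>
  have "integrable (lborel \<Otimes>\<^sub>M lborel) (\<lambda>(y, x). ?f x y)"
  proof (rule lborel_pair.Fubini_integrable)
    show "integrable lborel (\<lambda>y. \<integral>x. norm (case (y, x) of (y, x) \<Rightarrow> ?f x y) \<partial>lborel)"
      using h by (simp only: prod.case norm_eq) (simp add: has_bochner_integral_iff)
    show "AE y in lborel. integrable lborel (\<lambda>x. case (y, x) of (y, x) \<Rightarrow> ?f x y)"
      using fibre[OF \<kappa>] by (simp add: has_bochner_integral_iff)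
  qed measurable
  then have int: "integrable (lborel \<Otimes>\<^sub>M lborel) (case_prod ?f)"
    using lborel_pair.integrable_product_swap_iff[of "case_prod ?f"] by simp
  have "integral\<^sup>L (lborel \<Otimes>\<^sub>M lborel) (case_prod ?f) = (\<integral>y. (\<integral>x. ?f x y \<partial>lborel) \<partial>lborel)"
    using lborel_pair.integral_snd[OF int] by simp
  also have "\<dots> = (\<integral>y. h y * s y * A \<partial>lborel)"
    using fibre[OF \<kappa>] by (simp only: has_bochner_integral_iff)
  also have "\<dots> = B * A"
    using h by (simp add: has_bochner_integral_iff)
  finally show ?thesis
    using int by (simp add: has_bochner_integral_iff lborel_prod)
qed

section \<open>The substitution for the height\<close>

text \<open>The second identity is the first at \<open>- z\<close>, since \<open>arsinh\<close> is
  odd.\<close>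

lemma exp_arsinh_real:
  fixes z :: real
  shows "exp (arsinh z) = sqrt (z\<^sup>2 + 1) + z" and "1 / exp (arsinh z) = sqrt (z\<^sup>2 + 1) - z"
proof -
  have "exp (arsinh z) = sqrt (z\<^sup>2 + 1) + z" for z :: real
    unfolding arsinh_real_def using arsinh_real_aux[of z] by simp
  from this[of z] this[of "- z"]
  show "exp (arsinh z) = sqrt (z\<^sup>2 + 1) + z" and "1 / exp (arsinh z) = sqrt (z\<^sup>2 + 1) - z"
    by (simp_all add: exp_minus inverse_eq_divide)
qed

text \<open>With \<open>E = exp (arsinh z)\<close> the two summands are D times the squares of E and
  1 / E. These are the sum and the difference of \<open>sqrt (z\<^sup>2 + 1)\<close> and
  \<open>z\<close>, so the cross terms cancel.\<close>

lemma height_energy_eq: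
  fixes a D z :: real
  assumes "0 < a" and "0 < D"
  defines "y \<equiv> D / a * exp (2 * arsinh z)"
  shows "a * y + D\<^sup>2 / (a * y) = 2 * D + 4 * D * z\<^sup>2"
proof -
  have "a * y + D\<^sup>2 / (a * y) = D * ((exp (arsinh z))\<^sup>2 + (1 / exp (arsinh z))\<^sup>2)"
    using assms(1,2) unfolding y_def exp_double by (simp add: field_simps power2_eq_square)
  also have "\<dots> = 2 * D * ((sqrt (z\<^sup>2 + 1))\<^sup>2 + z\<^sup>2)"
    unfolding exp_arsinh_real(2) unfolding exp_arsinh_real(1) power2_sum power2_diff
    by (simp add: algebra_simps)
  also have "\<dots> = 2 * D + 4 * D * z\<^sup>2"
    by (simp add: algebra_simps)
  finally show ?thesis .
qed

text \<open>The Jacobian is \<open>2 * y / s\<close> with \<open>s = sqrt (z\<^sup>2 + 1)\<close>.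
  Against the factors \<open>1 / y\<^sup>2\<close> and \<open>sqrt (y / a)\<close> it leaves
  \<open>1 / (E * s)\<close> with \<open>E = exp (arsinh z)\<close>; as
  \<open>1 / E = s - z\<close>, this is the skew factor \<open>1 - z / s\<close>. The weight
  \<open>sqrt (y / a)\<close> is the width of the horizontal Gaussian at height
  \<open>y\<close>.\<close>

lemma has_bochner_integral_height_substitution:
  fixes a D B :: real and \<phi> :: "real \<Rightarrow> real"
  assumes a: "0 < a" and D: "0 < D" and [measurable]: "\<phi> \<in> borel_measurable borel"
    and int: "has_bochner_integral lborel
      (\<lambda>z. 2 * sqrt D / pi * ((1 - z / sqrt (z\<^sup>2 + 1)) * exp (- (4 * D * z\<^sup>2)) * \<phi> (D / a * exp (2 * arsinh z)))) B"
  shows "has_bochner_integral lborel (\<lambda>y. indicator {0<..} y *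
    (D * exp (2 * D) / pi / y\<^sup>2 * exp (- (a * y + D\<^sup>2 / (a * y))) * \<phi> y * sqrt (y / a))) B"
proof -
  let ?f = "\<lambda>y. D * exp (2 * D) / pi / y\<^sup>2 * exp (- (a * y + D\<^sup>2 / (a * y))) * \<phi> y * sqrt (y / a)"
  let ?g = "\<lambda>z::real. D / a * exp (2 * arsinh z)"
  let ?g' = "\<lambda>z::real. D / a * (exp (2 * arsinh z) * (2 / sqrt (z\<^sup>2 + 1)))"
  have der: "(?g has_field_derivative ?g' z) (at z within UNIV)" for z
    using a by (auto intro!: derivative_eq_intros simp: mult_ac)
  have inj: "inj ?g"
    using a D by (auto intro!: injI) (metis sinh_arsinh_real)
  have img: "range ?g = {0<..}"
  proof (intro equalityI subsetI)
    fix y :: real assume "y \<in> {0<..}"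
    \<comment> \<open>The witness solves \<open>2 * arsinh z = ln (a * y / D)\<close>.\<close>
    then show "y \<in> range ?g"
      using a D by (intro image_eqI[of _ _ "sinh (ln (a * y / D) / 2)"]) (auto simp: arsinh_sinh_real)
  qed (use a D in auto)
  have "\<bar>?g' z\<bar> * ?f (?g z) =
      2 * sqrt D / pi * ((1 - z / sqrt (z\<^sup>2 + 1)) * exp (- (4 * D * z\<^sup>2)) * \<phi> (?g z))" for z
  proof -
    define s where "s = sqrt (z\<^sup>2 + 1)"
    define E where "E = exp (arsinh z)"
    have s: "0 < s"
      unfolding s_def by (simp add: add_nonneg_pos)
    have E: "0 < E" "1 / E = s - z"
      unfolding E_def s_def by (rule exp_gt_zero, rule exp_arsinh_real(2))
    have g: "?g z = D / a * E\<^sup>2"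
      by (simp add: E_def exp_double)
    have expo: "exp (- (a * ?g z + D\<^sup>2 / (a * ?g z))) = exp (- (4 * D * z\<^sup>2)) / exp (2 * D)"
      unfolding height_energy_eq[OF a D] by (simp add: exp_diff[symmetric])
    have sq: "sqrt (?g z / a) = sqrt D / a * E"
      unfolding g using a D E(1) by (simp add: real_sqrt_mult real_sqrt_divide power2_eq_square)
    have g': "\<bar>?g' z\<bar> = D / a * (E\<^sup>2 * (2 / s))"
      using a D s unfolding s_def[symmetric] by (simp add: E_def exp_double)
    \<comment> \<open>Here \<open>e\<close>, \<open>X\<close>, \<open>v\<close>, \<open>q\<close>
      stand for \<open>exp (2 * D)\<close>, the Gaussian, the value of \<open>\<phi>\<close> and
      \<open>sqrt D\<close>, kept opaque so that only rational algebra remains.\<close>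
    have cancel: "(D / a * (E\<^sup>2 * (2 / s))) * (D * e / pi / (D / a * E\<^sup>2)\<^sup>2 * (X / e) * v * (q / a * E)) =
        2 * q / pi * ((1 / E) / s * X * v)" if "e \<noteq> 0" for e X v q
      using a D s E(1) that by (simp add: field_simps power2_eq_square)
    have "\<bar>?g' z\<bar> * ?f (?g z) = (D / a * (E\<^sup>2 * (2 / s))) * (D * exp (2 * D) / pi / (D / a * E\<^sup>2)\<^sup>2 *
        (exp (- (4 * D * z\<^sup>2)) / exp (2 * D)) * \<phi> (?g z) * (sqrt D / a * E))"
      unfolding expo sq g' unfolding g ..
    also have "\<dots> = 2 * sqrt D / pi * ((1 / E) / s * exp (- (4 * D * z\<^sup>2)) * \<phi> (?g z))"
      by (rule cancel) simp
    also have "(1 / E) / s = 1 - z / s"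
      unfolding E(2) using s by (simp add: diff_divide_distrib)
    finally show ?thesis unfolding s_def .
  qed
  then have "has_bochner_integral lborel (\<lambda>z. indicator UNIV z * (\<bar>?g' z\<bar> * ?f (?g z))) B"
    using int by (simp only: indicator_UNIV mult_1)
  then have "has_bochner_integral lborel (\<lambda>y. indicator {0<..} y * ?f y) B"
  proof (rule has_bochner_integral_substitution[THEN iffD2, OF _ img der inj, rotated 3])
    show "(\<lambda>y. indicator {0<..} y * ?f y) \<in> borel_measurable borel"
      by measurable
    show "(\<lambda>z. indicator UNIV z * (\<bar>?g' z\<bar> * ?f (?g z))) \<in> borel_measurable borel"
      by measurable
  qed simp
  then show ?thesis .
qed

section \<open>One-dimensional integrals against the skewed Gaussian\<close>

text \<open>The skew factor is 1 plus an odd function, and the latter drops out of the mass. With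
  \<open>k = 4 * D\<close>, the bracket in the second part is the portion of the log-density that
  depends on the height alone.\<close>

lemma has_bochner_integral_skewed_gaussian:
  fixes k C :: real
  assumes k: "0 < k"
  shows "has_bochner_integral lborel
      (\<lambda>z. (1 - z / sqrt (z\<^sup>2 + 1)) * exp (- (k * z\<^sup>2))) (sqrt (pi / k))" (is ?mass)
    and "has_bochner_integral lborel
      (\<lambda>z. (1 - z / sqrt (z\<^sup>2 + 1)) * exp (- (k * z\<^sup>2)) * (C - 4 * arsinh z - k * z\<^sup>2))
      (sqrt (pi / k) * (C - 1 / 2 + 2 * exp k * upper_Gamma 0 k))" (is ?log)
proof -
  let ?w = "\<lambda>z::real. exp (- (k * z\<^sup>2))"
  have G0: "has_bochner_integral lborel ?w (sqrt (pi / k))"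
    using has_bochner_integral_gaussian_even_moment[OF k, of 0] by simp
  have G2: "has_bochner_integral lborel (\<lambda>z. z\<^sup>2 * ?w z) (sqrt (pi / k) / (2 * k))"
    using has_bochner_integral_gaussian_even_moment[OF k, of 1] by (simp add: fact_numeral)
  \<comment> \<open>A quadratic bound makes the integrand dominated by \<open>G0\<close> and
    \<open>G2\<close>; reflection then gives 0.\<close>
  have odd: "has_bochner_integral lborel (\<lambda>z. f z * ?w z) 0"
    if "\<And>z. f (- z) = - f z" and "\<And>z. \<bar>f z\<bar> \<le> A + B * z\<^sup>2" and [measurable]: "f \<in> borel_measurable borel"
    for f :: "real \<Rightarrow> real" and A B
  proof (rule has_bochner_integral_odd_zero)
    have "integrable lborel (\<lambda>z. A * ?w z + B * (z\<^sup>2 * ?w z))"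
      using G0 G2 by (simp add: has_bochner_integral_iff)
    then show "integrable lborel (\<lambda>z. f z * ?w z)"
    proof (rule Bochner_Integration.integrable_bound)
      show "AE z in lborel. norm (f z * ?w z) \<le> norm (A * ?w z + B * (z\<^sup>2 * ?w z))"
      proof (rule AE_I2)
        fix z :: real
        have "norm (f z * ?w z) \<le> (A + B * z\<^sup>2) * ?w z"
          unfolding real_norm_def abs_mult using that(2)[of z] by (simp add: mult_right_mono)
        also have "\<dots> = A * ?w z + B * (z\<^sup>2 * ?w z)"
          by (simp add: algebra_simps)
        finally show "norm (f z * ?w z) \<le> norm (A * ?w z + B * (z\<^sup>2 * ?w z))"
          by simp
      qed
    qed simp
  qed (simp add: that(1))
  have slope: "\<bar>z / sqrt (z\<^sup>2 + 1)\<bar> \<le> 1" for z :: real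
  proof -
    have "\<bar>z\<bar> \<le> sqrt (z\<^sup>2 + 1)"
      by (intro real_le_rsqrt) simp
    then show ?thesis
      by (simp add: abs_divide divide_le_eq_1 add_nonneg_pos)
  qed
  have "has_bochner_integral lborel (\<lambda>z. z / sqrt (z\<^sup>2 + 1) * ?w z) 0"
    by (rule odd[where A=1 and B=0]) (use slope in simp_all)
  from has_bochner_integral_diff[OF G0 this] show ?mass
    by (simp add: left_diff_distrib)
  have "has_bochner_integral lborel (\<lambda>z. (z / sqrt (z\<^sup>2 + 1) * (C - k * z\<^sup>2)) * ?w z) 0"
  proof (rule odd[where A="\<bar>C\<bar>" and B=k])
    fix z :: real
    have "\<bar>z / sqrt (z\<^sup>2 + 1) * (C - k * z\<^sup>2)\<bar> \<le> 1 * \<bar>C - k * z\<^sup>2\<bar>"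
      unfolding abs_mult by (intro mult_right_mono slope) simp
    also have "\<dots> \<le> \<bar>C\<bar> + \<bar>k * z\<^sup>2\<bar>"
      by simp
    also have "\<bar>k * z\<^sup>2\<bar> = k * z\<^sup>2"
      using k by simp
    finally show "\<bar>z / sqrt (z\<^sup>2 + 1) * (C - k * z\<^sup>2)\<bar> \<le> \<bar>C\<bar> + k * z\<^sup>2" .
  qed simp_all
  note odd1 = this
  have odd2: "has_bochner_integral lborel (\<lambda>z. arsinh z * ?w z) 0"
  proof (rule odd[where A=1 and B=1])
    fix z :: real
    \<comment> \<open>From the square of \<open>\<bar>z\<bar> - 1\<close> being nonnegative.\<close>
    have "\<bar>z\<bar> \<le> 1 + z\<^sup>2"
      using zero_le_power2[of "\<bar>z\<bar> - 1"] unfolding power2_diff by simp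
    then show "\<bar>arsinh z\<bar> \<le> 1 + 1 * z\<^sup>2"
      using abs_arsinh_real_le[of z] by simp
  qed simp_all
  \<comment> \<open>Expansion of the product. The second moment yields the \<open>1 / 2\<close>; the
    skew factor times \<open>- 4 * arsinh z\<close> contains a product of two odd functions, which
    is even and produces the incomplete Gamma term.\<close>
  have "has_bochner_integral lborel
      (\<lambda>z. C * ?w z - k * (z\<^sup>2 * ?w z) + 4 * (z * arsinh z / sqrt (z\<^sup>2 + 1) * ?w z)
        - (z / sqrt (z\<^sup>2 + 1) * (C - k * z\<^sup>2)) * ?w z - 4 * (arsinh z * ?w z))
      (C * sqrt (pi / k) - k * (sqrt (pi / k) / (2 * k)) + 4 * (sqrt (pi / k) / 2 * exp k * upper_Gamma 0 k)
        - 0 - 4 * 0)"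
    by (intro has_bochner_integral_diff has_bochner_integral_add has_bochner_integral_mult_right
        G0 G2 has_bochner_integral_arsinh_gaussian k odd1 odd2)
  also have "(\<lambda>z. C * ?w z - k * (z\<^sup>2 * ?w z) + 4 * (z * arsinh z / sqrt (z\<^sup>2 + 1) * ?w z)
        - (z / sqrt (z\<^sup>2 + 1) * (C - k * z\<^sup>2)) * ?w z - 4 * (arsinh z * ?w z)) =
      (\<lambda>z. (1 - z / sqrt (z\<^sup>2 + 1)) * exp (- (k * z\<^sup>2)) * (C - 4 * arsinh z - k * z\<^sup>2))"
  proof (rule ext)
    fix z :: real
    define m where "m = z / sqrt (z\<^sup>2 + 1)"
    have "z * arsinh z / sqrt (z\<^sup>2 + 1) = m * arsinh z"
      by (simp add: m_def)
    then show "C * ?w z - k * (z\<^sup>2 * ?w z) + 4 * (z * arsinh z / sqrt (z\<^sup>2 + 1) * ?w z)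
        - (z / sqrt (z\<^sup>2 + 1) * (C - k * z\<^sup>2)) * ?w z - 4 * (arsinh z * ?w z) =
        (1 - z / sqrt (z\<^sup>2 + 1)) * exp (- (k * z\<^sup>2)) * (C - 4 * arsinh z - k * z\<^sup>2)"
      unfolding m_def[symmetric] by (simp only:) (simp add: algebra_simps)
  qed
  also have "C * sqrt (pi / k) - k * (sqrt (pi / k) / (2 * k)) + 4 * (sqrt (pi / k) / 2 * exp k * upper_Gamma 0 k)
        - 0 - 4 * 0 = sqrt (pi / k) * (C - 1 / 2 + 2 * exp k * upper_Gamma 0 k)"
    using k by (simp add: algebra_simps)
  finally show ?log .
qed

section \<open>The matrix and the density in completed-square form\<close>

lemma sym_pos_def_2_imp:
  fixes a b c :: real
  assumes "vector [vector [a, b], vector [b, c]] \<in> sym_pos_def"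
  shows "0 < a" and "0 < a * c - b\<^sup>2"
proof -
  let ?A = "vector [vector [a, b], vector [b, c]] :: real^2^2"
  have q: "v \<bullet> (?A *v v) = a * (v $ 1)\<^sup>2 + 2 * b * v $ 1 * v $ 2 + c * (v $ 2)\<^sup>2" for v
    by (simp add: inner_vec_def matrix_vector_mult_def sum_2 power2_eq_square algebra_simps)
  have pos: "0 < a * x\<^sup>2 + 2 * b * x * y + c * y\<^sup>2" if "x \<noteq> 0 \<or> y \<noteq> 0" for x y
  proof -
    have "(vector [x, y] :: real^2) \<noteq> 0"
      using that by (auto simp: vec_eq_iff forall_2)
    then have "0 < vector [x, y] \<bullet> (?A *v vector [x, y])"
      using assms unfolding sym_pos_def_def by blast
    then show ?thesis
      unfolding q by simp
  qed
  show a: "0 < a"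
    using pos[of 1 0] by simp
  \<comment> \<open>The quadratic form at \<open>(- b, a)\<close> equals \<open>a\<close> times the
    determinant.\<close>
  have "0 < a * (a * c - b\<^sup>2)"
    using pos[of "- b" a] a by (simp add: power2_eq_square algebra_simps)
  with a show "0 < a * c - b\<^sup>2"
    by (simp add: zero_less_mult_iff)
qed

text \<open>Completing the square in \<open>x\<close> leaves the remainder
  \<open>c - b\<^sup>2 / a = D\<^sup>2 / a\<close> over \<open>y\<close>. At each height the density
  is thus a Gaussian in \<open>x\<close> centred at \<open>- (b / a)\<close> with scale
  \<open>sqrt (y / a)\<close>.\<close>

lemma poincare_density_eq:
  fixes a b c D :: real
  defines "\<theta> \<equiv> vector [vector [a, b], vector [b, c]] :: real^2^2"
  assumes a: "0 < a" and det: "0 < a * c - b\<^sup>2" and D: "D = sqrt (det \<theta>)" and y: "0 < y"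
  shows "poincare_density \<theta> (x, y) = D * exp (2 * D) / pi / y\<^sup>2 * exp (- (a * y + D\<^sup>2 / (a * y))) *
    exp (- ((x - (- (b / a))) / sqrt (y / a))\<^sup>2)"
proof -
  have D2: "D\<^sup>2 = a * c - b\<^sup>2"
    using det by (simp add: D \<theta>_def det_2 power2_eq_square)
  have "((x - (- (b / a))) / sqrt (y / a))\<^sup>2 = (x + b / a)\<^sup>2 / (y / a)"
    using a y by (simp add: power_divide)
  then have "(a * (x\<^sup>2 + y\<^sup>2) + 2 * b * x + c) / y =
      (a * y + D\<^sup>2 / (a * y)) + ((x - (- (b / a))) / sqrt (y / a))\<^sup>2"
    using a y unfolding D2 by (simp add: field_simps power2_eq_square)
  moreover have "poincare_density \<theta> (x, y) = D * exp (2 * D) / pi *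
      exp (- ((a * (x\<^sup>2 + y\<^sup>2) + 2 * b * x + c) / y)) * (1 / y\<^sup>2)"
    unfolding poincare_density_def D by (simp add: \<theta>_def)
  ultimately show ?thesis
    by (simp add: exp_diff exp_minus divide_inverse)
qed

section \<open>Assembly of the entropy\<close>

theorem proposition6:
  fixes a b c D :: real and \<theta> :: "real ^ 2 ^ 2"
  assumes "\<theta> = vector [vector [a, b], vector [b, c]]"
    and "\<theta> \<in> sym_pos_def"
    and "D = sqrt (det \<theta>)"
  shows "D = sqrt (a * c - b\<^sup>2) \<and>
    has_differential_entropy upper_half_plane (poincare_density \<theta>) \<and>
    differential_entropy upper_half_plane (poincare_density \<theta>) =
      1 + ln (pi * D) - 2 * ln a - 2 * exp (4 * D) * upper_Gamma 0 (4 * D)"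
proof -
  have a: "0 < a" and det: "0 < a * c - b\<^sup>2"
    using sym_pos_def_2_imp assms(1,2) by simp_all
  have D_eq: "D = sqrt (a * c - b\<^sup>2)"
    by (simp add: assms(1,3) det_2 power2_eq_square)
  then have D: "0 < D"
    using det by simp
  define N where "N = D * exp (2 * D) / pi"
  \<comment> \<open>On the half-plane the log-density is \<open>L y\<close> minus the square of the
    standardised horizontal variable. \<open>C\<close> is the constant term of \<open>L\<close>
    after the height substitution, and \<open>I\<close> will be the mean of
    \<open>L\<close>.\<close>
  define L where "L = (\<lambda>y. ln N - 2 * ln y - (a * y + D\<^sup>2 / (a * y)))"
  define C where "C = ln N - 2 * ln (D / a) - 2 * D"
  define h where "h = (\<lambda>y. indicator {0<..} y * (N / y\<^sup>2 * exp (- (a * y + D\<^sup>2 / (a * y)))))"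
  define s where "s = (\<lambda>y. sqrt (y / a))"
  define I where "I = C - 1 / 2 + 2 * exp (4 * D) * upper_Gamma 0 (4 * D)"
  have N: "0 < N"
    using D by (simp add: N_def)
  have [measurable]: "L \<in> borel_measurable borel" "h \<in> borel_measurable borel" "s \<in> borel_measurable borel"
    unfolding L_def h_def s_def by measurable
  \<comment> \<open>The remaining \<open>1 / sqrt pi\<close> is compensated by the mass
    \<open>sqrt pi\<close> of the horizontal Gaussian.\<close>
  have norm: "2 * sqrt D / pi * (sqrt (pi / (4 * D)) * u) = u / sqrt pi" for u
  proof -
    have "pi = sqrt pi * sqrt pi" by simp
    then show ?thesis
      using D by (simp add: real_sqrt_divide real_sqrt_mult) (simp add: field_simps)
  qed
  \<comment> \<open>Taking \<open>\<phi> = 1\<close> gives the total height weight, used with the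
    horizontal second moment.\<close>
  have "has_bochner_integral lborel (\<lambda>y. indicator {0<..} y *
      (D * exp (2 * D) / pi / y\<^sup>2 * exp (- (a * y + D\<^sup>2 / (a * y))) * 1 * sqrt (y / a))) (1 / sqrt pi)"
    using has_bochner_integral_mult_right[OF has_bochner_integral_skewed_gaussian(1)[of "4 * D"], of "2 * sqrt D / pi"]
      norm[of 1] D
    by (intro has_bochner_integral_height_substitution[OF a D]) simp_all
  then have h1: "has_bochner_integral lborel (\<lambda>y. h y * s y) (1 / sqrt pi)"
    by (simp add: h_def s_def N_def mult.assoc)
  have L_g: "L (D / a * exp (2 * arsinh z)) = C - 4 * arsinh z - 4 * D * z\<^sup>2" for z
    unfolding L_def height_energy_eq[OF a D] C_def
    using a D ln_mult[of "D / a" "exp (2 * arsinh z)"] by simp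
  have "has_bochner_integral lborel (\<lambda>y. indicator {0<..} y *
      (D * exp (2 * D) / pi / y\<^sup>2 * exp (- (a * y + D\<^sup>2 / (a * y))) * L y * sqrt (y / a))) (I / sqrt pi)"
    using has_bochner_integral_mult_right[OF has_bochner_integral_skewed_gaussian(2)[of "4 * D" C], of "2 * sqrt D / pi"]
      D
    by (intro has_bochner_integral_height_substitution[OF a D])
      (simp_all only: L_g norm I_def, simp_all)
  then have hL: "has_bochner_integral lborel (\<lambda>y. h y * L y * s y) (I / sqrt pi)"
    by (simp add: h_def s_def N_def mult.assoc)
  have s_pos: "0 < s y" if "h y \<noteq> 0" for y
    using that a by (auto simp: h_def s_def indicator_def split: if_splits)
  have "has_bochner_integral lborel (\<lambda>w::real. exp (- w\<^sup>2)) (sqrt pi)"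
    using has_bochner_integral_gaussian_even_moment[of 1 0] by simp
  then have int1: "has_bochner_integral lborel
      (\<lambda>(x, y). h y * L y * exp (- ((x - (- (b / a))) / s y)\<^sup>2)) (I / sqrt pi * sqrt pi)"
    by (rule has_bochner_integral_scaled_fibres[OF _ hL]) (use s_pos in auto)
  \<comment> \<open>The standardised square has mean 1 / 2, so the mean of the log-density is
    \<open>I - 1 / 2\<close>.\<close>
  have "has_bochner_integral lborel (\<lambda>w::real. w\<^sup>2 * exp (- w\<^sup>2)) (sqrt pi / 2)"
    using has_bochner_integral_gaussian_even_moment[of 1 1] by (simp add: fact_numeral)
  then have int2: "has_bochner_integral lborel
      (\<lambda>(x, y). h y * (((x - (- (b / a))) / s y)\<^sup>2 * exp (- ((x - (- (b / a))) / s y)\<^sup>2))) (1 / sqrt pi * (sqrt pi / 2))"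
    by (rule has_bochner_integral_scaled_fibres[OF _ h1]) (use s_pos in auto)
  have integrand: "indicator upper_half_plane z *\<^sub>R (poincare_density \<theta> z * ln (poincare_density \<theta> z)) =
      (case z of (x, y) \<Rightarrow> h y * L y * exp (- ((x - (- (b / a))) / s y)\<^sup>2)) -
      (case z of (x, y) \<Rightarrow> h y * (((x - (- (b / a))) / s y)\<^sup>2 * exp (- ((x - (- (b / a))) / s y)\<^sup>2)))" for z
  proof -
    obtain x y where z: "z = (x, y)" by (cases z)
    show ?thesis
    proof (cases "0 < y")
      case True
      let ?w = "(x - (- (b / a))) / s y"
      have p: "poincare_density \<theta> z = h y * exp (- ?w\<^sup>2)"
        using poincare_density_eq[OF a det, of D y x] True assms(1,3)
        by (simp add: z h_def s_def N_def)
      have log: "ln (h y * exp (- ?w\<^sup>2)) = L y - ?w\<^sup>2"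
        using True N by (simp add: h_def L_def ln_mult ln_div ln_realpow)
      show ?thesis
        using True unfolding p log by (simp add: z upper_half_plane_def algebra_simps)
    qed (simp add: z upper_half_plane_def h_def)
  qed
  have "has_bochner_integral lborel
      (\<lambda>z. indicator upper_half_plane z *\<^sub>R (poincare_density \<theta> z * ln (poincare_density \<theta> z)))
      (I / sqrt pi * sqrt pi - 1 / sqrt pi * (sqrt pi / 2))"
    unfolding integrand by (rule has_bochner_integral_diff[OF int1 int2])
  then have "has_differential_entropy upper_half_plane (poincare_density \<theta>)"
    and "differential_entropy upper_half_plane (poincare_density \<theta>) = 1 / 2 - I"
    unfolding has_differential_entropy_def differential_entropy_def set_integrable_def
      set_lebesgue_integral_def
    by (simp_all add: has_bochner_integral_iff)
  \<comment> \<open>The terms \<open>2 * D\<close> from \<open>ln N\<close> and from the energy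
    cancel, leaving \<open>C = 2 * ln a - ln (pi * D)\<close>.\<close>
  moreover have "1 / 2 - I = 1 + ln (pi * D) - 2 * ln a - 2 * exp (4 * D) * upper_Gamma 0 (4 * D)"
    using a D by (simp add: I_def C_def N_def ln_mult ln_div)
  ultimately show ?thesis
    using D_eq by simp
qed

end
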